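(* Let $I=1$. For each $\nu>0$ with $1/\nu\in\mathbb{N}$, let $p_\nu$ be a prior on $V_\nu=\{0,\nu,2\nu,\ldots,1\}$, and suppose that as $\nu\to 0$, $p_\nu$ converges weakly to a distribution on $[0,1]$ with a density $\rho$ that is positive almost everywhere on $[0,1]$. Then there exist constants $A>0$ and $X>0$ (depending only on $\rho$) such that for every $\epsilon>0$ there exist $\bar\nu>0$ and $\bar k\in\mathbb{N}$ such that for all $\nu\le\bar\nu$ and all $k\ge\bar k$, the exponential price mechanism with $k$ messages, $a=A\cdot k$ and the constant $X$ guarantees, under the prior $p_\nu$, a revenue of at least $R^*(p_\nu)-\epsilon$, where $R^*(p_\nu)$ is the optimal revenue guarantee under prior $p_\nu$.
   Context: Setting: a single good is sold to buyers $\mathcal I=\{1,\ldots,I\}$ who have a common value $v\in V=\{0,\nu,2\nu,\ldots,1\}$ with known prior $p\in\Delta(V)$, and quasi-linear utility. A mechanism consists of finite message sets $M_i$ (with $M=\prod_i M_i$), allocation rules $q_i:M\to[0,1]$ with $\sum_i q_i(m)\le 1$, and payment rules $P_i:M\to\mathbb R$; each $M_i$ contains an opt-out message $0$ with $q_i(0,m_{-i})=P_i(0,m_{-i})=0$ for all $m_{-i}$. Buyer $i$'s utility is $U_i(v,m)=v\,q_i(m)-P_i(m)$. A Bayes correlated equilibrium (BCE) of the mechanism is a $\mu\in\Delta(V\times M)$ with $\sum_m\mu(v,m)=p(v)$ for all $v$ and $\sum_{(v,m_{-i})}\mu(v,m)\big(U_i(v,(m_i,m_{-i}))-U_i(v,(m_i',m_{-i}))\big)\ge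 0$ for all $i$ and all $m_i,m_i'\in M_i$. A mechanism guarantees revenue $R$ if every BCE $\mu$ satisfies $\sum_{(v,m)}\sum_i\mu(v,m)P_i(m)\ge R$. The optimal revenue guarantee $R^*(p)$ is the supremum over all mechanisms of the minimum over BCE of the expected revenue $\sum_{(v,m)}\sum_i\mu(v,m)P_i(m)$. Exponential price mechanism (parameters $k\ge1$, $a>0$, $X>0$): $M_i=\{0,1,\ldots,k\}$ for all $i$; it is symmetric, i.e. $q_i(m)=q(m_i,m_{-i})$ and $P_i(m)=P(m_i,m_{-i})$ where $q,P$ are invariant under permutations of the entries of $m_{-i}$. The allocation is defined by $q(0,m_{-1})=0$ and, for $0\le m_1\le k-1$, $q(m_1+1,m_{-1})-q(m_1,m_{-1})=\frac1k\cdot\frac{1}{|\mathrm{rank}(m_1,m_{-1})|}\sum_{j\in\mathrm{rank}(m_1,m_{-1})}\frac1j$, where $\mathrm{rank}(m_1,m_{-1})\subseteq\{1,\ldots,I\}$ is the set of positions (counting from the top, ties occupying consecutive positions) that the value $m_1$ occupies in the list $(m_1,\ldots,m_I)$ sorted in decreasing order (e.g. $\mathrm{rank}(20,10,20,40,30)=\{3,4\}$). The payment is $P(m_1,m_{-1})=X\big((1+1/a)^{m_1}-1\big)$. For $I=1$ this is $q(m_1)=m_1/k$, $P(m_1)=X((1+1/a)^{m_1}-1)$, $m_1\in\{0,\ldots,k\}$. *)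

theory Defs
  imports "HOL-Analysis.Analysis"
begin

text \<open>Single buyer (I = 1). Grid of values: for N = 1/nu, the value with index j (0 \<le> j \<le> N)
  is j / N. A prior is a function p from indices {0..N} to reals.
  Messages are natural numbers; a mechanism is a finite message set M containing the
  opt-out message 0, an allocation q and a payment P.\<close>

definition val :: "nat \<Rightarrow> nat \<Rightarrow> real" where
  "val N j = real j / real N"

definition is_prior :: "nat \<Rightarrow> (nat \<Rightarrow> real) \<Rightarrow> bool" where
  "is_prior N p \<longleftrightarrow> (\<forall>j\<le>N. p j \<ge> 0) \<and> (\<Sum>j\<le>N. p j) = 1"

definition is_mechanism :: "nat set \<Rightarrow> (nat \<Rightarrow> real) \<Rightarrow> (nat \<Rightarrow> real) \<Rightarrow> bool" where
  "is_mechanism M q P \<longleftrightarrow> finite M \<and> 0 \<in> M \<and> (\<forall>m\<in>M. 0 \<le> q m \<and> q m \<le> 1)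
     \<and> q 0 = 0 \<and> P 0 = 0"

definition util :: "nat \<Rightarrow> (nat \<Rightarrow> real) \<Rightarrow> (nat \<Rightarrow> real) \<Rightarrow> nat \<Rightarrow> nat \<Rightarrow> real" where
  "util N q P j m = val N j * q m - P m"

text \<open>Bayes correlated equilibrium: mu j m is the probability of (value index j, message m).\<close>
definition is_BCE :: "nat \<Rightarrow> (nat \<Rightarrow> real) \<Rightarrow> nat set \<Rightarrow> (nat \<Rightarrow> real) \<Rightarrow> (nat \<Rightarrow> real)
    \<Rightarrow> (nat \<Rightarrow> nat \<Rightarrow> real) \<Rightarrow> bool" where
  "is_BCE N p M q P mu \<longleftrightarrow>
     (\<forall>j\<le>N. \<forall>m\<in>M. mu j m \<ge> 0) \<and>
     (\<forall>j\<le>N. (\<Sum>m\<in>M. mu j m) = p j) \<and>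
     (\<forall>m\<in>M. \<forall>m'\<in>M. (\<Sum>j\<le>N. mu j m * (util N q P j m - util N q P j m')) \<ge> 0)"

definition revenue :: "nat \<Rightarrow> nat set \<Rightarrow> (nat \<Rightarrow> real) \<Rightarrow> (nat \<Rightarrow> nat \<Rightarrow> real) \<Rightarrow> real" where
  "revenue N M P mu = (\<Sum>j\<le>N. \<Sum>m\<in>M. mu j m * P m)"

definition guarantees :: "nat \<Rightarrow> (nat \<Rightarrow> real) \<Rightarrow> nat set \<Rightarrow> (nat \<Rightarrow> real) \<Rightarrow> (nat \<Rightarrow> real)
    \<Rightarrow> real \<Rightarrow> bool" where
  "guarantees N p M q P R \<longleftrightarrow> (\<forall>mu. is_BCE N p M q P mu \<longrightarrow> revenue N M P mu \<ge> R)"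

definition R_star :: "nat \<Rightarrow> (nat \<Rightarrow> real) \<Rightarrow> real" where
  "R_star N p = Sup {R. \<exists>M q P. is_mechanism M q P \<and> guarantees N p M q P R}"

definition exp_M :: "nat \<Rightarrow> nat set" where
  "exp_M k = {0..k}"

definition exp_q :: "nat \<Rightarrow> nat \<Rightarrow> real" where
  "exp_q k m = real m / real k"

definition exp_P :: "real \<Rightarrow> real \<Rightarrow> nat \<Rightarrow> real" where
  "exp_P a X m = X * ((1 + 1 / a) ^ m - 1)"

definition density01 :: "(real \<Rightarrow> real) \<Rightarrow> bool" where
  "density01 rho \<longleftrightarrow> rho \<in> borel_measurable lborel \<and> set_integrable lborel {0..1} rho
     \<and> (\<forall>x\<in>{0..1}. rho x \<ge> 0) \<and> (LINT x:{0..1}|lborel. rho x) = 1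
     \<and> (AE x in lborel. x \<in> {0..1} \<longrightarrow> rho x > 0)"

definition weak_conv :: "(nat \<Rightarrow> nat \<Rightarrow> real) \<Rightarrow> (real \<Rightarrow> real) \<Rightarrow> bool" where
  "weak_conv p rho \<longleftrightarrow> (\<forall>f::real \<Rightarrow> real. continuous_on {0..1} f \<longrightarrow>
     ((\<lambda>N. \<Sum>j\<le>N. p N j * f (val N j)) \<longlonglongrightarrow> (LINT x:{0..1}|lborel. rho x * f x)))"

end

theory Submission
  imports Defs
begin

text \<open>
  Write \<open>h s\<close> for the expectation of \<open>min v s\<close>. If the buyer observes a signal whose posterior mean
  has survival function \<open>\<pi> / s\<close> above \<open>\<pi>\<close>, truncated at the top, then every posted price, hence every
  mechanism, earns at most \<open>\<pi>\<close>. Such a signal exists as soon as \<open>h s \<le> \<pi> (1 + ln (s / \<pi>))\<close> for all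
  \<open>s \<ge> \<pi>\<close>, by Strassen's theorem; so the optimal guarantee is at most the least such \<open>\<pi>\<close>, at which the
  inequality is tight at some \<open>b\<close>.
  Conversely, in the exponential price mechanism the upward deviation constraints alone give revenue
  at least \<open>A h c - X\<close>, where \<open>c = (X / A) (1 + 1 / (A k))^k\<close> tends to \<open>(X / A) exp (1 / A)\<close>.
  With \<open>A = 1 / ln (b / \<pi>)\<close> and \<open>X = A \<pi>\<close> this limit is \<open>b\<close>, and tightness at \<open>b\<close>
  makes the bound equal to \<open>\<pi>\<close>.
\<close>

section \<open>Martingale couplings on a grid\<close>

text \<open>The part of \<open>f\<close> between its quantiles \<open>s\<close> and \<open>s + w\<close>.\<close>

definition slice :: "(nat \<Rightarrow> real) \<Rightarrow> real \<Rightarrow> real \<Rightarrow> nat \<Rightarrow> real" where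
  "slice f w s j =
     max s (min (s + w) (\<Sum>i<Suc j. f i)) - max s (min (s + w) (\<Sum>i<j. f i))"

lemma slice_bounds:
  assumes "f j \<ge> 0"
  shows "0 \<le> slice f w s j" "slice f w s j \<le> f j"
  using assms by (auto simp: slice_def max_def min_def)

lemma sum_slice:
  assumes "0 \<le> w" "0 \<le> s" "s + w \<le> (\<Sum>j\<le>N. f j)"
  shows "(\<Sum>j\<le>N. slice f w s j) = w"
proof -
  have "(\<Sum>j\<le>N. slice f w s j)
      = max s (min (s + w) (\<Sum>i<Suc N. f i)) - max s (min (s + w) 0)"
    unfolding slice_def lessThan_Suc_atMost [symmetric]
    by (subst sum_lessThan_telescope) simp
  also have "\<dots> = w"
    using assms by (simp add: lessThan_Suc_atMost del: sum.lessThan_Suc)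
  finally show ?thesis .
qed

text \<open>The running sum of \<open>f\<close> crosses \<open>s\<close> at index \<open>c\<close>
  and \<open>s + w\<close> at index \<open>d\<close>, so the slice takes all the mass strictly
  between these indices and cuts only at them. The disjunctions cover the extreme slices: nothing is
  lost on the left if \<open>s = 0\<close>, nor on the right if \<open>s + w\<close> is the total
  mass.\<close>

lemma slice_support:
  assumes f: "\<And>j. j \<le> N \<Longrightarrow> f j \<ge> 0"
    and w: "0 < w" and s: "0 \<le> s" "s + w \<le> (\<Sum>j\<le>N. f j)"
  obtains c d where "c \<le> N" "d \<le> N"
    "\<And>j. j < c \<Longrightarrow> slice f w s j = 0"
    "\<And>j. j \<le> N \<Longrightarrow> d < j \<Longrightarrow> slice f w s j = 0"
    "\<And>j. j \<le> N \<Longrightarrow> s = 0 \<or> c < j \<Longrightarrow> s + w = (\<Sum>j\<le>N. f j) \<or> j < d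
       \<Longrightarrow> slice f w s j = f j"
proof -
  define C where "C j = (\<Sum>i<j. f i)" for j
  have tot: "(\<Sum>j\<le>N. f j) = C (Suc N)"
    by (simp only: C_def lessThan_Suc_atMost)
  have C0: "C 0 = 0" by (simp add: C_def)
  have CS: "C (Suc j) = C j + f j" for j by (simp add: C_def)
  have mono: "C i \<le> C j" if "i \<le> j" "j \<le> Suc N" for i j
    unfolding C_def using that f by (intro sum_mono2) auto
  have sl: "slice f w s j = max s (min (s + w) (C (Suc j))) - max s (min (s + w) (C j))" for j
    by (simp only: slice_def C_def)
  define c where "c = (LEAST j. s < C (Suc j))"
  have cN: "s < C (Suc N)" using s w tot by simp
  have c1: "s < C (Suc c)" unfolding c_def using cN by (rule LeastI)
  have c2: "c \<le> N" unfolding c_def using cN by (rule Least_le)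
  have c3: "C (Suc j) \<le> s" if "j < c" for j
    using not_less_Least [of j "\<lambda>j. s < C (Suc j)"] that by (simp add: c_def)
  define D where "D = {j. j \<le> N \<and> C j < s + w}"
  have D: "finite D" "0 \<in> D" using C0 s w by (auto simp: D_def)
  define d where "d = Max D"
  have dD: "d \<in> D" unfolding d_def using D by (intro Max_in) auto
  have d2: "s + w \<le> C j" if "d < j" "j \<le> N" for j
  proof (rule ccontr)
    assume "\<not> s + w \<le> C j"
    then have "j \<in> D" using that by (simp add: D_def)
    then show False using Max_ge [OF D(1)] that by (force simp: d_def)
  qed
  show thesis
  proof
    show "c \<le> N" "d \<le> N" using c2 dD by (auto simp: D_def)
    show "slice f w s j = 0" if "j < c" for j
    proof -
      have "C j \<le> C (Suc j)" using that c2 by (intro mono) auto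
      then show ?thesis using c3 [OF that] by (simp add: sl max_def min_def)
    qed
    show "slice f w s j = 0" if "j \<le> N" "d < j" for j
    proof -
      have "C j \<le> C (Suc j)" using that by (intro mono) auto
      then show ?thesis using d2 [OF that(2,1)] w by (simp add: sl max_def min_def)
    qed
    show "slice f w s j = f j"
      if j: "j \<le> N" and lo: "s = 0 \<or> c < j" and hi: "s + w = (\<Sum>j\<le>N. f j) \<or> j < d" for j
    proof -
      have 1: "s \<le> C j"
      proof (cases "s = 0")
        case True
        then show ?thesis using mono [of 0 j] C0 j by simp
      next
        case False
        then have "C (Suc c) \<le> C j" using lo j by (intro mono) auto
        then show ?thesis using c1 by simp
      qed
      have 2: "C (Suc j) \<le> s + w"
      proof (cases "j < d")
        case True
        then have "C (Suc j) \<le> C d" using dD by (intro mono) (auto simp: D_def)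
        then show ?thesis using dD by (simp add: D_def)
      next
        case False
        then have "s + w = C (Suc N)" using hi tot by simp
        then show ?thesis using mono [of "Suc j" "Suc N"] j by simp
      qed
      have "C j \<le> C (Suc j)" using j by (intro mono) auto
      then show ?thesis using 1 2 CS [of j] by (simp add: sl)
    qed
  qed
qed

lemma continuous_on_slice: "continuous_on A (\<lambda>s. slice f w s j)"
  unfolding slice_def by (intro continuous_intros)

text \<open>As \<open>s\<close> grows, the barycentre of the slice moves continuously from the left end of \<open>f\<close> to the
  right end; convex order puts \<open>x\<close> in between.\<close>

lemma exists_shadow:
  fixes f :: "nat \<Rightarrow> real" and g :: "nat \<Rightarrow> real"
  assumes f: "\<And>j. j \<le> N \<Longrightarrow> f j \<ge> 0"
    and S: "finite S" and x: "x \<in> S" and g: "\<And>y. y \<in> S \<Longrightarrow> g y \<ge> 0" and gx: "g x > 0"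
    and mass: "(\<Sum>j\<le>N. f j) = (\<Sum>y\<in>S. g y)"
    and mean: "(\<Sum>j\<le>N. f j * real j) = (\<Sum>y\<in>S. g y * real y)"
    and cx: "\<And>t. t \<le> N \<Longrightarrow> (\<Sum>y\<in>S. g y * max 0 (real t - real y))
               \<le> (\<Sum>j\<le>N. f j * max 0 (real t - real j))"
  obtains f1 c d where "c \<le> N" "d \<le> N"
    "\<And>j. j \<le> N \<Longrightarrow> 0 \<le> f1 j" "\<And>j. j \<le> N \<Longrightarrow> f1 j \<le> f j"
    "(\<Sum>j\<le>N. f1 j) = g x" "(\<Sum>j\<le>N. f1 j * real j) = g x * real x"
    "\<And>j. j < c \<Longrightarrow> f1 j = 0" "\<And>j. j \<le> N \<Longrightarrow> d < j \<Longrightarrow> f1 j = 0"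
    "\<And>j. c < j \<Longrightarrow> j < d \<Longrightarrow> f1 j = f j"
proof -
  define w where "w = g x"
  define T where "T = (\<Sum>j\<le>N. f j) - w"
  have w: "0 < w" using gx by (simp add: w_def)
  have T: "0 \<le> T"
    using member_le_sum [of x S g] x g S mass by (simp add: T_def w_def)
  define b where "b s = (\<Sum>j\<le>N. slice f w s j * real j)" for s
  have ms: "(\<Sum>j\<le>N. slice f w s j) = w" if "0 \<le> s" "s \<le> T" for s
    using that w by (intro sum_slice) (auto simp: T_def)
  \<comment> \<open>The slice at \<open>s = 0\<close> is the leftmost mass of \<open>f\<close>. At
    its right end \<open>d\<close> its put equals the put of all of \<open>f\<close>, which
    dominates the put of the atom of \<open>g\<close> at \<open>x\<close>.\<close>
  have lo: "b 0 \<le> w * real x"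
  proof -
    obtain c d where cd: "d \<le> N" "\<And>j. j \<le> N \<Longrightarrow> d < j \<Longrightarrow> slice f w 0 j = 0"
      "\<And>j. j \<le> N \<Longrightarrow> j < d \<Longrightarrow> slice f w 0 j = f j"
      by (rule slice_support [of N f w 0]) (use f w T in \<open>auto simp: T_def\<close>)
    have "w * real d - b 0 = (\<Sum>j\<le>N. slice f w 0 j * (real d - real j))"
      using ms [of 0] T by (simp add: b_def right_diff_distrib sum_subtractf flip: sum_distrib_right)
    also have "\<dots> = (\<Sum>j\<le>N. f j * max 0 (real d - real j))"
    proof (rule sum.cong [OF refl])
      fix j assume "j \<in> {..N}"
      then show "slice f w 0 j * (real d - real j) = f j * max 0 (real d - real j)"
        using cd(2) [of j] cd(3) [of j] by (cases j d rule: linorder_cases) auto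
    qed
    also have "\<dots> \<ge> (\<Sum>y\<in>S. g y * max 0 (real d - real y))" by (rule cx [OF cd(1)])
    also have "(\<Sum>y\<in>S. g y * max 0 (real d - real y)) \<ge> g x * max 0 (real d - real x)"
      using S x g by (intro member_le_sum [where f = "\<lambda>y. g y * max 0 (real d - real y)"]) auto
    also have "g x * max 0 (real d - real x) \<ge> w * (real d - real x)"
      unfolding w_def [symmetric] using w by (intro mult_left_mono) auto
    finally show ?thesis by (simp add: algebra_simps)
  qed
  have hi: "w * real x \<le> b T"
  proof -
    obtain c d where cd: "c \<le> N" "\<And>j. j < c \<Longrightarrow> slice f w T j = 0"
      "\<And>j. j \<le> N \<Longrightarrow> c < j \<Longrightarrow> slice f w T j = f j"
      by (rule slice_support [of N f w T]) (use f w T in \<open>auto simp: T_def\<close>)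
    \<comment> \<open>Put-call parity: with equal masses and means, the hypothesis on puts becomes
      one on calls, and the rightmost slice can be tested at its left end \<open>c\<close>.\<close>
    have split: "max 0 (real j - real c) = max 0 (real c - real j) + (real j - real c)" for j
      by auto
    have "w * (real x - real c) \<le> g x * max 0 (real x - real c)"
      unfolding w_def [symmetric] using w by (intro mult_left_mono) auto
    also have "\<dots> \<le> (\<Sum>y\<in>S. g y * max 0 (real y - real c))"
      using S x g by (intro member_le_sum [where f = "\<lambda>y. g y * max 0 (real y - real c)"]) auto
    also have "\<dots> = (\<Sum>y\<in>S. g y * max 0 (real c - real y))
        + ((\<Sum>y\<in>S. g y * real y) - (\<Sum>y\<in>S. g y) * real c)"
      unfolding split by (simp add: algebra_simps sum.distrib sum_subtractf sum_distrib_left)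
    also have "\<dots> \<le> (\<Sum>j\<le>N. f j * max 0 (real c - real j))
        + ((\<Sum>j\<le>N. f j * real j) - (\<Sum>j\<le>N. f j) * real c)"
      using cx [OF cd(1)] mass mean by simp
    also have "\<dots> = (\<Sum>j\<le>N. f j * max 0 (real j - real c))"
      unfolding split by (simp add: algebra_simps sum.distrib sum_subtractf sum_distrib_left)
    also have "\<dots> = (\<Sum>j\<le>N. slice f w T j * (real j - real c))"
    proof (rule sum.cong [OF refl])
      fix j assume "j \<in> {..N}"
      then show "f j * max 0 (real j - real c) = slice f w T j * (real j - real c)"
        using cd(2) [of j] cd(3) [of j] by (cases j c rule: linorder_cases) auto
    qed
    also have "\<dots> = b T - w * real c"
      using ms [of T] T by (simp add: b_def right_diff_distrib sum_subtractf flip: sum_distrib_right)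
    finally show ?thesis by (simp add: algebra_simps)
  qed
  have "continuous_on {0..T} b"
    unfolding b_def by (intro continuous_intros continuous_on_slice)
  then obtain s where s: "0 \<le> s" "s \<le> T" "b s = w * real x"
    using IVT' [of b 0 "w * real x" T] lo hi T by auto
  obtain c d where cd: "c \<le> N" "d \<le> N"
    "\<And>j. j < c \<Longrightarrow> slice f w s j = 0"
    "\<And>j. j \<le> N \<Longrightarrow> d < j \<Longrightarrow> slice f w s j = 0"
    "\<And>j. j \<le> N \<Longrightarrow> c < j \<Longrightarrow> j < d \<Longrightarrow> slice f w s j = f j"
    by (rule slice_support [of N f w s]) (use f w s in \<open>auto simp: T_def\<close>)
  show thesis
  proof (rule that [of c d "slice f w s"])
    show "slice f w s j = f j" if "c < j" "j < d" for j using that cd by simp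
  qed (use cd f s ms slice_bounds in \<open>auto simp: b_def w_def\<close>)
qed

text \<open>Strassen's theorem, by induction over the atoms of \<open>g\<close>. The column of the
  atom \<open>x\<close> is a piece \<open>f1\<close> of \<open>f\<close> with mass
  \<open>g x\<close> and barycentre \<open>x\<close>; the point is that the rest of \<open>f\<close>
  still dominates the other atoms in convex order. The last conjunct is the martingale
  property.\<close>

lemma martingale_coupling:
  fixes f :: "nat \<Rightarrow> real" and g :: "nat \<Rightarrow> real"
  assumes "finite S"
    and "\<And>j. j \<le> N \<Longrightarrow> f j \<ge> 0" and "\<And>y. y \<in> S \<Longrightarrow> g y \<ge> 0"
    and "(\<Sum>j\<le>N. f j) = (\<Sum>y\<in>S. g y)"
    and "(\<Sum>j\<le>N. f j * real j) = (\<Sum>y\<in>S. g y * real y)"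
    and "\<And>t. t \<le> N \<Longrightarrow> (\<Sum>y\<in>S. g y * max 0 (real t - real y))
               \<le> (\<Sum>j\<le>N. f j * max 0 (real t - real j))"
  shows "\<exists>\<gamma>. (\<forall>j\<le>N. \<forall>y\<in>S. \<gamma> j y \<ge> 0) \<and> (\<forall>j\<le>N. (\<Sum>y\<in>S. \<gamma> j y) = f j)
     \<and> (\<forall>y\<in>S. (\<Sum>j\<le>N. \<gamma> j y) = g y \<and> (\<Sum>j\<le>N. \<gamma> j y * real j) = g y * real y)"
  using assms
proof (induction S arbitrary: f rule: finite_induct)
  case empty
  then have "f j = 0" if "j \<le> N" for j
    using that sum_nonneg_eq_0_iff [of "{..N}" f] by auto
  then show ?case by auto
next
  case (insert x S)
  note f = insert.prems(1) and g = insert.prems(2) and mass = insert.prems(3)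
    and mean = insert.prems(4) and cx = insert.prems(5)
  obtain f1 where f1: "\<And>j. j \<le> N \<Longrightarrow> 0 \<le> f1 j" "\<And>j. j \<le> N \<Longrightarrow> f1 j \<le> f j"
    "(\<Sum>j\<le>N. f1 j) = g x" "(\<Sum>j\<le>N. f1 j * real j) = g x * real x"
    and cx1: "\<And>t. t \<le> N \<Longrightarrow> (\<Sum>y\<in>S. g y * max 0 (real t - real y))
               \<le> (\<Sum>j\<le>N. (f j - f1 j) * max 0 (real t - real j))"
  proof (cases "g x = 0")
    case True
    show thesis
      by (rule that [of "\<lambda>_. 0"]) (use True f cx insert.hyps in auto)
  next
    case False
    then have gx: "g x > 0" using g [of x] by simp
    obtain f1 c d where f1: "c \<le> N" "d \<le> N"
      "\<And>j. j \<le> N \<Longrightarrow> 0 \<le> f1 j" "\<And>j. j \<le> N \<Longrightarrow> f1 j \<le> f j"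
      "(\<Sum>j\<le>N. f1 j) = g x" "(\<Sum>j\<le>N. f1 j * real j) = g x * real x"
      "\<And>j. j < c \<Longrightarrow> f1 j = 0" "\<And>j. j \<le> N \<Longrightarrow> d < j \<Longrightarrow> f1 j = 0"
      "\<And>j. c < j \<Longrightarrow> j < d \<Longrightarrow> f1 j = f j"
      by (rule exists_shadow [of N f "insert x S" x g]) (use f g gx mass mean cx insert.hyps in auto)
    define G where "G t = (\<Sum>y\<in>S. g y * max 0 (real t - real y))" for t
    define F where "F t = (\<Sum>j\<le>N. (f j - f1 j) * max 0 (real t - real j))" for t
    have F: "F t = (\<Sum>j\<le>N. f j * max 0 (real t - real j)) - (\<Sum>j\<le>N. f1 j * max 0 (real t - real j))" for t
      by (simp add: F_def left_diff_distrib sum_subtractf)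
    have G: "G t + g x * max 0 (real t - real x) \<le> (\<Sum>j\<le>N. f j * max 0 (real t - real j))"
      if "t \<le> N" for t
      using cx [OF that] insert.hyps by (simp add: G_def)
    \<comment> \<open>The piece \<open>f1\<close> has no mass below \<open>c\<close>, so removing it
      leaves the put of \<open>f\<close> at \<open>t\<close> unchanged.\<close>
    have low: "G t \<le> F t" if "t \<le> c" for t
    proof -
      have "(\<Sum>j\<le>N. f1 j * max 0 (real t - real j)) = 0"
      proof (rule sum.neutral, rule ballI)
        fix j show "f1 j * max 0 (real t - real j) = 0"
          using f1(7) [of j] that by (cases "j < c") auto
      qed
      moreover have "0 \<le> g x * max 0 (real t - real x)" using gx by simp
      ultimately show ?thesis using G [of t] that f1(1) F [of t] by linarith
    qed
    \<comment> \<open>All of \<open>f1\<close> lies at or below \<open>d\<close>, so its put at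
      \<open>t\<close> is \<open>g x * (real t - real x)\<close>, at most the put of the atom that
      is removed from \<open>g\<close>.\<close>
    have high: "G t \<le> F t" if "d \<le> t" "t \<le> N" for t
    proof -
      have "(\<Sum>j\<le>N. f1 j * max 0 (real t - real j)) = (\<Sum>j\<le>N. f1 j * (real t - real j))"
      proof (rule sum.cong [OF refl])
        fix j assume "j \<in> {..N}"
        then show "f1 j * max 0 (real t - real j) = f1 j * (real t - real j)"
          using f1(8) [of j] that by (cases "d < j") auto
      qed
      also have "\<dots> = g x * (real t - real x)"
        using f1(5,6) by (simp add: right_diff_distrib sum_subtractf flip: sum_distrib_right)
      also have "\<dots> \<le> g x * max 0 (real t - real x)" using gx by (intro mult_left_mono) auto
      finally show ?thesis using G [of t] that F [of t] by linarith
    qed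
    \<comment> \<open>What is left of \<open>f\<close> has no mass strictly between \<open>c\<close> and \<open>d\<close>, so its put function is
      affine there, and it suffices to compare convex functions at the two end points.\<close>
    have mid: "G t \<le> F t" if t: "c < t" "t < d" for t
    proof -
      define \<alpha> where "\<alpha> = (real d - real t) / (real d - real c)"
      define \<beta> where "\<beta> = (real t - real c) / (real d - real c)"
      have ab: "\<alpha> \<ge> 0" "\<beta> \<ge> 0" "\<alpha> + \<beta> = 1"
        using t by (auto simp: \<alpha>_def \<beta>_def add_divide_distrib [symmetric])
      have t_eq: "real t = \<alpha> * real c + \<beta> * real d"
      proof -
        have "real t * (real d - real c) = (real d - real t) * real c + (real t - real c) * real d"
          by (simp add: algebra_simps)
        then show ?thesis using t unfolding \<alpha>_def \<beta>_def
          by (simp add: eq_divide_eq flip: add_divide_distrib)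
      qed
      have aff: "real t - real y = \<alpha> * (real c - real y) + \<beta> * (real d - real y)" for y
        using ab(3) t_eq by algebra
      have cvx: "max 0 (real t - real y) \<le> \<alpha> * max 0 (real c - real y) + \<beta> * max 0 (real d - real y)" for y
      proof -
        have "\<alpha> * (real c - real y) \<le> \<alpha> * max 0 (real c - real y)"
          "\<beta> * (real d - real y) \<le> \<beta> * max 0 (real d - real y)"
          using ab by (auto intro: mult_left_mono)
        then show ?thesis using aff [of y] ab by auto
      qed
      have "G t \<le> (\<Sum>y\<in>S. g y * (\<alpha> * max 0 (real c - real y) + \<beta> * max 0 (real d - real y)))"
        unfolding G_def using g cvx by (intro sum_mono mult_left_mono) auto
      also have "\<dots> = \<alpha> * G c + \<beta> * G d"
        by (simp add: G_def distrib_left sum.distrib sum_distrib_left mult_ac)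
      also have "\<dots> \<le> \<alpha> * F c + \<beta> * F d"
        using ab low [of c] high [of d] f1 by (intro add_mono mult_left_mono) auto
      also have "\<dots> = (\<Sum>j\<le>N. (f j - f1 j) * (\<alpha> * max 0 (real c - real j) + \<beta> * max 0 (real d - real j)))"
        by (simp add: F_def distrib_left sum.distrib sum_distrib_left mult_ac)
      also have "\<dots> = F t"
        unfolding F_def
      proof (rule sum.cong [OF refl])
        fix j
        consider "j \<le> c" | "c < j" "j < d" | "d \<le> j" by linarith
        then show "(f j - f1 j) * (\<alpha> * max 0 (real c - real j) + \<beta> * max 0 (real d - real j))
            = (f j - f1 j) * max 0 (real t - real j)"
        proof cases
          case 1 then show ?thesis using aff [of j] t by simp
        next
          case 2 then show ?thesis using f1(9) [of j] by simp
        next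
          case 3 then show ?thesis using t by simp
        qed
      qed
      finally show ?thesis .
    qed
    show thesis
    proof (rule that [of f1])
      fix t assume "t \<le> N"
      then have "G t \<le> F t" using low high mid by (meson not_less)
      then show "(\<Sum>y\<in>S. g y * max 0 (real t - real y))
               \<le> (\<Sum>j\<le>N. (f j - f1 j) * max 0 (real t - real j))"
        by (simp add: G_def F_def)
    qed (use f1 in auto)
  qed
  have "\<exists>\<gamma>. (\<forall>j\<le>N. \<forall>y\<in>S. \<gamma> j y \<ge> 0) \<and> (\<forall>j\<le>N. (\<Sum>y\<in>S. \<gamma> j y) = f j - f1 j)
     \<and> (\<forall>y\<in>S. (\<Sum>j\<le>N. \<gamma> j y) = g y \<and> (\<Sum>j\<le>N. \<gamma> j y * real j) = g y * real y)"
    using f1 cx1 mass mean g insert.hyps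
    by (intro insert.IH) (auto simp: sum_subtractf left_diff_distrib)
  then obtain \<gamma> where \<gamma>: "\<forall>j\<le>N. \<forall>y\<in>S. \<gamma> j y \<ge> 0" "\<forall>j\<le>N. (\<Sum>y\<in>S. \<gamma> j y) = f j - f1 j"
     "\<forall>y\<in>S. (\<Sum>j\<le>N. \<gamma> j y) = g y \<and> (\<Sum>j\<le>N. \<gamma> j y * real j) = g y * real y"
    by blast
  define \<gamma>' where "\<gamma>' j y = (if y = x then f1 j else \<gamma> j y)" for j y
  have eq: "(\<Sum>y\<in>S. \<gamma>' j y) = (\<Sum>y\<in>S. \<gamma> j y)" for j
    using insert.hyps by (intro sum.cong) (auto simp: \<gamma>'_def)
  have eqx: "\<gamma>' j x = f1 j" for j by (simp add: \<gamma>'_def)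
  have eqy: "\<gamma>' j y = \<gamma> j y" if "y \<in> S" for j y using that insert.hyps by (auto simp: \<gamma>'_def)
  show ?case
    by (rule exI [of _ \<gamma>']) (use \<gamma> f1 insert.hyps in \<open>auto simp: eq eqx eqy\<close>)
qed

section \<open>Upper bound on the revenue guarantee\<close>

definition mean_min :: "nat \<Rightarrow> (nat \<Rightarrow> real) \<Rightarrow> real \<Rightarrow> real" where
  "mean_min N f s = (\<Sum>j\<le>N. f j * min (val N j) s)"

text \<open>Expectation of \<open>min v s\<close> when \<open>v\<close> has survival function \<open>min 1 (\<pi> / v)\<close>.\<close>

definition pareto_mean_min :: "real \<Rightarrow> real \<Rightarrow> real" where
  "pareto_mean_min \<pi> s = (if s \<le> \<pi> then s else \<pi> * (1 + ln (s / \<pi>)))"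

text \<open>The buyer is shown a signal of law \<open>g\<close> whose value is the posterior mean,
  and answers any mechanism optimally. The resulting equilibrium earns no more than a mixture of
  posted prices facing a value of law \<open>g\<close>, and each such price earns at most
  \<open>r\<close>.\<close>

lemma R_star_le_of_contraction:
  assumes N: "N \<ge> 1" and pr: "is_prior N f"
    and g: "\<And>x. x \<le> N \<Longrightarrow> g x \<ge> 0" and mass: "(\<Sum>x\<le>N. g x) = 1"
    and mean: "(\<Sum>j\<le>N. f j * real j) = (\<Sum>x\<le>N. g x * real x)"
    and cx: "\<And>t. t \<le> N \<Longrightarrow> (\<Sum>x\<le>N. g x * max 0 (real t - real x))
               \<le> (\<Sum>j\<le>N. f j * max 0 (real t - real j))"
    and r: "r \<ge> 0" and price: "\<And>y. 1 \<le> y \<Longrightarrow> y \<le> N \<Longrightarrow> val N y * (\<Sum>x=y..N. g x) \<le> r"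
  shows "R_star N f \<le> r"
proof -
  have f: "\<And>j. j \<le> N \<Longrightarrow> f j \<ge> 0" "(\<Sum>j\<le>N. f j) = 1"
    using pr by (auto simp: is_prior_def)
  have "\<exists>\<gamma>. (\<forall>j\<le>N. \<forall>x\<in>{..N}. \<gamma> j x \<ge> 0) \<and> (\<forall>j\<le>N. (\<Sum>x\<le>N. \<gamma> j x) = f j)
     \<and> (\<forall>x\<in>{..N}. (\<Sum>j\<le>N. \<gamma> j x) = g x \<and> (\<Sum>j\<le>N. \<gamma> j x * real j) = g x * real x)"
    by (rule martingale_coupling) (use f g mass mean cx in auto)
  then obtain \<gamma> where "\<forall>j\<le>N. \<forall>x\<in>{..N}. \<gamma> j x \<ge> 0" "\<forall>j\<le>N. (\<Sum>x\<le>N. \<gamma> j x) = f j"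
    "\<forall>x\<in>{..N}. (\<Sum>j\<le>N. \<gamma> j x) = g x \<and> (\<Sum>j\<le>N. \<gamma> j x * real j) = g x * real x"
    by blast
  then have \<gamma>: "\<And>j x. j \<le> N \<Longrightarrow> x \<le> N \<Longrightarrow> \<gamma> j x \<ge> 0"
    "\<And>j. j \<le> N \<Longrightarrow> (\<Sum>x\<le>N. \<gamma> j x) = f j"
    "\<And>x. x \<le> N \<Longrightarrow> (\<Sum>j\<le>N. \<gamma> j x) = g x"
    "\<And>x. x \<le> N \<Longrightarrow> (\<Sum>j\<le>N. \<gamma> j x * real j) = g x * real x"
    by auto
  \<comment> \<open>Utility is affine in the value, so averaging over the values behind the signal
    \<open>x\<close> amounts to evaluation at \<open>val N x\<close>.\<close>
  have \<gamma>_aff: "(\<Sum>j\<le>N. \<gamma> j x * (val N j * \<alpha> - \<beta>)) = g x * (val N x * \<alpha> - \<beta>)"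
    if "x \<le> N" for x \<alpha> \<beta>
  proof -
    have "(\<Sum>j\<le>N. \<gamma> j x * (val N j * \<alpha> - \<beta>))
        = (\<Sum>j\<le>N. \<gamma> j x * real j) * (\<alpha> / real N) - (\<Sum>j\<le>N. \<gamma> j x) * \<beta>"
      by (simp add: val_def algebra_simps sum_subtractf sum_distrib_left sum_distrib_right)
    then show ?thesis using \<gamma>(3,4) [OF that] by (simp add: val_def algebra_simps)
  qed
  show ?thesis
    unfolding R_star_def
  proof (rule cSup_least)
    have "is_mechanism {0} (\<lambda>_. 0) (\<lambda>_. 0)" "guarantees N f {0} (\<lambda>_. 0) (\<lambda>_. 0) 0"
      by (auto simp: is_mechanism_def guarantees_def revenue_def)
    then show "{R. \<exists>M q P. is_mechanism M q P \<and> guarantees N f M q P R} \<noteq> {}" by blast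
  next
    fix R assume "R \<in> {R. \<exists>M q P. is_mechanism M q P \<and> guarantees N f M q P R}"
    then obtain M q P where mech: "is_mechanism M q P" and guar: "guarantees N f M q P R" by blast
    have M: "finite M" "0 \<in> M" "q 0 = 0" "P 0 = 0" and q01: "\<And>i. i \<in> M \<Longrightarrow> 0 \<le> q i \<and> q i \<le> 1"
      using mech by (auto simp: is_mechanism_def)
    have "\<exists>i\<in>M. \<forall>i'\<in>M. util N q P x i' \<le> util N q P x i" for x
    proof -
      have "Max (util N q P x ` M) \<in> util N q P x ` M" using M by (intro Max_in) auto
      then obtain i where "i \<in> M" "util N q P x i = Max (util N q P x ` M)" by force
      then show ?thesis using M by (intro bexI [of _ i]) auto
    qed
    then obtain m where m: "\<And>x. m x \<in> M" "\<And>x i. i \<in> M \<Longrightarrow> util N q P x i \<le> util N q P x (m x)"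
      by metis
    \<comment> \<open>The signal \<open>x\<close> is replaced by a message \<open>m x\<close> that
      is optimal for it. Merging signals with the same message preserves obedience.\<close>
    define mu where "mu j i = (\<Sum>x\<le>N. if m x = i then \<gamma> j x else 0)" for j i
    have mu_sum: "(\<Sum>i\<in>M. mu j i * h i) = (\<Sum>x\<le>N. \<gamma> j x * h (m x))" for j and h :: "nat \<Rightarrow> real"
    proof -
      have "(\<Sum>i\<in>M. mu j i * h i) = (\<Sum>i\<in>M. \<Sum>x\<le>N. if m x = i then \<gamma> j x * h i else 0)"
        by (simp add: mu_def sum_distrib_right if_distrib [of "\<lambda>z. z * _"] cong: if_cong)
      also have "\<dots> = (\<Sum>x\<le>N. \<Sum>i\<in>M. if m x = i then \<gamma> j x * h i else 0)" by (rule sum.swap)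
      also have "\<dots> = (\<Sum>x\<le>N. \<gamma> j x * h (m x))"
        using M m by simp
      finally show ?thesis .
    qed
    have "is_BCE N f M q P mu"
      unfolding is_BCE_def
    proof (intro conjI allI impI ballI)
      show "0 \<le> mu j i" if "j \<le> N" for j i
        using \<gamma>(1) that by (auto simp: mu_def intro!: sum_nonneg)
      show "(\<Sum>i\<in>M. mu j i) = f j" if "j \<le> N" for j
        using mu_sum [of j "\<lambda>_. 1"] \<gamma>(2) that by simp
      show "0 \<le> (\<Sum>j\<le>N. mu j i * (util N q P j i - util N q P j i'))" if "i \<in> M" "i' \<in> M" for i i'
      proof -
        have u: "util N q P j i - util N q P j i' = val N j * (q i - q i') - (P i - P i')" for j
          by (simp add: util_def algebra_simps)
        have "(\<Sum>j\<le>N. mu j i * (util N q P j i - util N q P j i'))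
          = (\<Sum>j\<le>N. \<Sum>x\<le>N. if m x = i then \<gamma> j x * (val N j * (q i - q i') - (P i - P i')) else 0)"
          unfolding u by (simp add: mu_def sum_distrib_right if_distrib [of "\<lambda>z. z * _"] cong: if_cong)
        also have "\<dots> = (\<Sum>x\<le>N. \<Sum>j\<le>N. if m x = i then \<gamma> j x * (val N j * (q i - q i') - (P i - P i')) else 0)"
          by (rule sum.swap)
        also have "\<dots> = (\<Sum>x\<le>N. if m x = i then g x * (util N q P x i - util N q P x i') else 0)"
          unfolding u by (intro sum.cong) (auto simp: \<gamma>_aff)
        also have "\<dots> \<ge> 0"
          using g m(2) that by (intro sum_nonneg) auto
        finally show ?thesis .
      qed
    qed
    then have "R \<le> revenue N M P mu" using guar by (auto simp: guarantees_def)
    also have "\<dots> = (\<Sum>j\<le>N. \<Sum>x\<le>N. \<gamma> j x * P (m x))"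
      by (simp add: revenue_def mu_sum)
    also have "\<dots> = (\<Sum>x\<le>N. \<Sum>j\<le>N. \<gamma> j x * P (m x))" by (rule sum.swap)
    also have "\<dots> = (\<Sum>x\<le>N. g x * P (m x))"
      by (intro sum.cong) (auto simp: \<gamma>(3) simp flip: sum_distrib_right)
    \<comment> \<open>Payments are bounded by telescoping the constraints that \<open>Suc y\<close>
      does not imitate \<open>y\<close>; the opt-out message gives
      \<open>P (m 0) \<le> 0\<close>.\<close>
    also have "\<dots> \<le> (\<Sum>x\<le>N. g x * (\<Sum>y<x. val N (Suc y) * (q (m (Suc y)) - q (m y))))"
    proof (intro sum_mono mult_left_mono)
      fix x
      show "P (m x) \<le> (\<Sum>y<x. val N (Suc y) * (q (m (Suc y)) - q (m y)))"
      proof (induction x)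
        case 0
        then show ?case using m(2) [of 0 0] M by (simp add: util_def val_def)
      next
        case (Suc x)
        then show ?case using m(2) [of "m x" "Suc x"] m(1) by (simp add: util_def algebra_simps)
      qed
    qed (use g in auto)
    \<comment> \<open>Exchanging the sums displays a mixture of posted prices
      \<open>val N (Suc y)\<close> with weights \<open>q (m (Suc y)) - q (m y)\<close>.\<close>
    also have "\<dots> = (\<Sum>y<N. \<Sum>x=Suc y..N. g x * (val N (Suc y) * (q (m (Suc y)) - q (m y))))"
      unfolding sum_distrib_left by (rule sum.nested_swap')
    also have "\<dots> = (\<Sum>y<N. (val N (Suc y) * (\<Sum>x=Suc y..N. g x)) * (q (m (Suc y)) - q (m y)))"
      by (simp add: sum_distrib_left sum_distrib_right mult_ac)
    also have "\<dots> \<le> (\<Sum>y<N. r * (q (m (Suc y)) - q (m y)))"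
    proof (intro sum_mono mult_right_mono)
      fix y assume "y \<in> {..<N}"
      then show "val N (Suc y) * (\<Sum>x=Suc y..N. g x) \<le> r" using price [of "Suc y"] by simp
      \<comment> \<open>Adding the two constraints between \<open>y\<close> and \<open>Suc y\<close>
        shows that the allocation is increasing, so the weights are nonnegative.\<close>
      have "0 \<le> (val N (Suc y) - val N y) * (q (m (Suc y)) - q (m y))"
        using m(2) [of "m y" "Suc y"] m(2) [of "m (Suc y)" y] m(1)
        by (simp add: util_def algebra_simps)
      moreover have "val N (Suc y) - val N y = 1 / real N"
        by (simp add: val_def add_divide_distrib)
      ultimately show "0 \<le> q (m (Suc y)) - q (m y)" using N by (simp add: zero_le_divide_iff)
    qed
    also have "\<dots> = r * (q (m N) - q (m 0))"
      by (simp add: sum_lessThan_telescope [of "\<lambda>y. q (m y)"] flip: sum_distrib_left)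
    also have "\<dots> \<le> r * 1"
      using r q01 [of "m N"] q01 [of "m 0"] m(1) by (intro mult_left_mono) (auto simp: algebra_simps)
    finally show "R \<le> r" by simp
  qed
qed

text \<open>Concavity: the survival function \<open>min 1 (\<pi> / s)\<close> is the slope at
  \<open>s\<close>, and the graph lies below its tangents. Off the linear part this reduces to
  \<open>ln x \<le> x - 1\<close>.\<close>

lemma pareto_mean_min_tangent:
  assumes "0 < \<pi>" "0 < s" "0 \<le> y"
  shows "pareto_mean_min \<pi> y \<le> pareto_mean_min \<pi> s + min 1 (\<pi> / s) * (y - s)"
proof -
  consider "s \<le> \<pi>" "y \<le> \<pi>" | "s \<le> \<pi>" "\<pi> < y" | "\<pi> < s" "\<pi> < y" | "\<pi> < s" "y \<le> \<pi>" by linarith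
  then show ?thesis
  proof cases
    case 1
    then show ?thesis using assms by (simp add: pareto_mean_min_def min_def)
  next
    case 2
    have "\<pi> * (1 + ln (y / \<pi>)) \<le> \<pi> * (y / \<pi>)"
      using assms 2 ln_le_minus_one [of "y / \<pi>"] by (intro mult_left_mono) auto
    then show ?thesis using 2 assms by (simp add: pareto_mean_min_def min_def)
  next
    case 3
    have "\<pi> * ln (y / s) \<le> \<pi> * (y / s - 1)"
      using assms 3 ln_le_minus_one [of "y / s"] by (intro mult_left_mono) auto
    also have "\<dots> = \<pi> / s * (y - s)" using assms by (simp add: field_simps)
    finally show ?thesis using 3 assms
      by (simp add: pareto_mean_min_def min_def ln_div distrib_left right_diff_distrib)
  next
    case 4
    have "y * (1 - \<pi> / s) \<le> \<pi> * (1 - \<pi> / s)"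
      using 4 assms by (intro mult_right_mono) auto
    also have "\<dots> \<le> \<pi> * ln (s / \<pi>)"
      using assms 4 ln_le_minus_one [of "\<pi> / s"] by (intro mult_left_mono) (auto simp: ln_div)
    finally have "y \<le> \<pi> + \<pi> * ln (s / \<pi>) + \<pi> / s * (y - s)" using assms by (simp add: field_simps)
    then show ?thesis using 4 assms
      by (simp add: pareto_mean_min_def min_def distrib_left)
  qed
qed

lemma pareto_mean_min_mono:
  assumes "0 < \<pi>" "s \<le> t"
  shows "pareto_mean_min \<pi> s \<le> pareto_mean_min \<pi> t"
proof (cases "s \<le> \<pi> \<and> \<pi> < t")
  case True
  have "\<pi> * 1 \<le> \<pi> * (1 + ln (t / \<pi>))" using True assms by (intro mult_left_mono) auto
  then show ?thesis using True by (simp add: pareto_mean_min_def)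
next
  case False
  then show ?thesis using assms by (auto simp: pareto_mean_min_def divide_right_mono)
qed

text \<open>The Pareto law is cut off so that it has the mean of the prior and is then discretised
  to the grid; the hypothesis makes the result a mean-preserving contraction of the prior.
  Discretisation costs \<open>1 / real N\<close>: the probability of sale at a grid price is a slope
  over the cell to its left, hence is at most \<pi> divided by the previous grid point.\<close>

lemma R_star_le:
  assumes N: "N \<ge> 1" and pr: "is_prior N f" and \<pi>: "0 < \<pi>"
    and le: "\<And>t. t \<le> N \<Longrightarrow> mean_min N f (val N t) \<le> pareto_mean_min \<pi> (val N t)"
  shows "R_star N f \<le> \<pi> + 1 / real N"
proof -
  have f: "\<And>j. j \<le> N \<Longrightarrow> f j \<ge> 0" "(\<Sum>j\<le>N. f j) = 1"
    using pr by (auto simp: is_prior_def)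
  have N0: "real N > 0" using N by simp
  define M where "M = mean_min N f 1"
  \<comment> \<open>The cap \<open>M\<close> is the mean of the prior, as values are at most 1. It
    forces equal means and keeps \<open>u\<close> concave.\<close>
  define u where "u s = min (pareto_mean_min \<pi> s) M" for s
  define U where "U t = real N * u (val N t)" for t
  \<comment> \<open>\<open>T\<close> is the survival function of the law \<open>g\<close> on the grid whose truncated means interpolate \<open>u\<close>.\<close>
  define T where "T y = (if y = 0 then 1 else if y \<le> N then U y - U (y - 1) else 0)" for y
  define g where "g y = T y - T (Suc y)" for y
  have v1: "val N N = 1" using N by (simp add: val_def)
  have valS: "val N (Suc y) = val N y + 1 / real N" for y by (simp add: val_def add_divide_distrib)
  have v0: "val N y \<ge> 0" for y by (simp add: val_def)
  have mm: "mean_min N f s \<le> M" for s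
  proof -
    have "val N j \<le> 1" if "j \<le> N" for j using that N by (simp add: val_def)
    then show ?thesis unfolding mean_min_def M_def using f by (intro sum_mono mult_left_mono) auto
  qed
  have M0: "M \<ge> 0" unfolding M_def mean_min_def using f v0 by (auto intro!: sum_nonneg)
  have u_mono: "u s \<le> u t" if "s \<le> t" for s t
    using pareto_mean_min_mono [OF \<pi> that] by (auto simp: u_def)
  have U0: "U 0 = 0" using M0 \<pi> by (simp add: U_def u_def val_def pareto_mean_min_def)
  have UN: "U N = real N * M" using le [of N] v1 by (simp add: U_def u_def M_def)
  have U1: "U 1 \<le> 1"
  proof -
    have "pareto_mean_min \<pi> (1 / real N) \<le> 1 / real N"
      using pareto_mean_min_tangent [of \<pi> \<pi> "1 / real N"] \<pi> N by (simp add: pareto_mean_min_def)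
    then have "u (val N 1) \<le> 1 / real N" by (simp add: u_def val_def)
    then show ?thesis using N0 unfolding U_def by (simp add: field_simps)
  qed
  have T_nonneg: "T y \<ge> 0" for y
    using u_mono [of "val N (y - 1)" "val N y"] N0
    by (auto simp: T_def U_def val_def divide_right_mono intro!: mult_left_mono)
  have T_anti: "T (Suc y) \<le> T y" for y
  proof -
    consider "y = 0" | "1 \<le> y" "y < N" | "N \<le> y" "y \<noteq> 0" by linarith
    then show ?thesis
    proof cases
      case 1
      then show ?thesis using U1 U0 N by (simp add: T_def)
    next
      case 2
      then obtain z where z: "y = Suc z" by (cases y) auto
      define s where "s = val N y"
      define h where "h = 1 / real N"
      have s: "s > 0" using 2 by (simp add: s_def val_def)
      have vals: "val N (Suc y) = s + h" "val N z = s - h" using valS [of y] valS [of z] z by (auto simp: s_def h_def)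
      have "0 \<le> s - h" using v0 [of z] vals by simp
      have h: "h \<ge> 0" by (simp add: h_def)
      \<comment> \<open>Concavity of \<open>u\<close>: where the cap binds, both neighbours are at
        most \<open>M\<close>; elsewhere the Pareto tangent at \<open>s\<close> bounds both.\<close>
      have "u (s + h) + u (s - h) \<le> 2 * u s"
      proof (cases "u s = M")
        case True
        then show ?thesis by (simp add: u_def)
      next
        case False
        then have "u s = pareto_mean_min \<pi> s" by (simp add: u_def min_def split: if_splits)
        moreover have "u (s + h) \<le> pareto_mean_min \<pi> (s + h)" "u (s - h) \<le> pareto_mean_min \<pi> (s - h)"
          by (auto simp: u_def)
        moreover have "pareto_mean_min \<pi> (s + h) \<le> pareto_mean_min \<pi> s + min 1 (\<pi> / s) * h"
          using pareto_mean_min_tangent [of \<pi> s "s + h"] \<pi> s h by simp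
        moreover have "pareto_mean_min \<pi> (s - h) \<le> pareto_mean_min \<pi> s - min 1 (\<pi> / s) * h"
          using pareto_mean_min_tangent [of \<pi> s "s - h"] \<pi> s \<open>0 \<le> s - h\<close> by simp
        ultimately show ?thesis by linarith
      qed
      then have "real N * (u (s + h) + u (s - h)) \<le> real N * (2 * u s)"
        by (intro mult_left_mono) auto
      then show ?thesis using 2 z by (simp add: T_def U_def vals vals(1) [unfolded z] s_def algebra_simps)
    next
      case 3
      then show ?thesis using T_nonneg [of y] by (simp add: T_def)
    qed
  qed
  have tail: "(\<Sum>x=y..N. g x) = T y" if "y \<le> N" for y
  proof -
    have "(\<Sum>x=y..N. g x) = (\<Sum>x=y..N. - T (Suc x) - - T x)" by (simp add: g_def)
    also have "\<dots> = T y - T (Suc N)" using that by (subst sum_Suc_diff) auto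
    finally show ?thesis by (simp add: T_def)
  qed
  have cdf: "(\<Sum>x\<le>y. g x) = 1 - T (Suc y)" for y
    unfolding g_def by (induction y) (auto simp: T_def)
  \<comment> \<open>From \<open>t\<close> to \<open>Suc t\<close> the put of \<open>g\<close> grows
    by the mass on \<open>{..t}\<close>, which is one minus an increment of
    \<open>U\<close>.\<close>
  have put: "(\<Sum>x\<le>N. g x * max 0 (real t - real x)) = real t - U t" if "t \<le> N" for t
    using that
  proof (induction t)
    case 0
    then show ?case using U0 by simp
  next
    case (Suc t)
    have "(\<Sum>x\<le>N. g x * max 0 (real (Suc t) - real x))
        = (\<Sum>x\<le>N. g x * max 0 (real t - real x) + (if x \<le> t then g x else 0))"
      by (intro sum.cong) (auto simp: algebra_simps)
    also have "\<dots> = real t - U t + (\<Sum>x\<le>N. if x \<le> t then g x else 0)"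
      using Suc by (simp add: sum.distrib)
    also have "(\<Sum>x\<le>N. if x \<le> t then g x else 0) = (\<Sum>x\<le>t. g x)"
      using Suc.prems by (intro sum.mono_neutral_cong_right) auto
    also have "\<dots> = 1 - (U (Suc t) - U t)" using Suc.prems by (simp add: cdf T_def)
    finally show ?case by simp
  qed
  have put_f: "(\<Sum>j\<le>N. f j * max 0 (real t - real j)) = real t - real N * mean_min N f (val N t)" for t
  proof -
    have "max 0 (real t - real j) = real t - real N * min (val N j) (val N t)" for j
      using N0 by (auto simp: val_def min_def divide_le_cancel)
    then have "(\<Sum>j\<le>N. f j * max 0 (real t - real j)) = (\<Sum>j\<le>N. f j) * real t - real N * mean_min N f (val N t)"
      by (simp add: mean_min_def right_diff_distrib sum_subtractf sum_distrib_left sum_distrib_right mult_ac)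
    then show ?thesis using f by simp
  qed
  have mean_of_put: "(\<Sum>j\<le>N. w j * real j) = (\<Sum>j\<le>N. w j) * real N - (\<Sum>j\<le>N. w j * max 0 (real N - real j))"
    for w :: "nat \<Rightarrow> real"
  proof -
    have "(\<Sum>j\<le>N. w j * real j) = (\<Sum>j\<le>N. w j * real N - w j * max 0 (real N - real j))"
      by (intro sum.cong) (auto simp: algebra_simps)
    then show ?thesis by (simp add: sum_subtractf sum_distrib_right)
  qed
  have mass: "(\<Sum>x\<le>N. g x) = 1" using cdf [of N] by (simp add: T_def)
  show ?thesis
  proof (rule R_star_le_of_contraction [OF N pr, of g])
    show "0 \<le> g x" for x using T_anti by (simp add: g_def)
    show "(\<Sum>x\<le>N. g x) = 1" by (rule mass)
    show "(\<Sum>j\<le>N. f j * real j) = (\<Sum>x\<le>N. g x * real x)"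
      by (simp only: mean_of_put put [OF order_refl] put_f mass f(2) UN v1 M_def)
    show "(\<Sum>x\<le>N. g x * max 0 (real t - real x)) \<le> (\<Sum>j\<le>N. f j * max 0 (real t - real j))"
      if "t \<le> N" for t
      using le [OF that] mm [of "val N t"] N0
      unfolding put [OF that] put_f by (auto simp: U_def u_def)
    show "0 \<le> \<pi> + 1 / real N" using \<pi> by simp
    show "val N y * (\<Sum>x=y..N. g x) \<le> \<pi> + 1 / real N" if y: "1 \<le> y" "y \<le> N" for y
    \<comment> \<open>The lowest positive price has no positive grid point before it at which to
      take a tangent, but it is itself only \<open>1 / real N\<close>.\<close>
    proof (cases "y = 1")
      case True
      then have "val N y * T y \<le> val N y * 1"
        using U0 U1 that by (intro mult_left_mono) (auto simp: T_def v0)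
      then show ?thesis using \<pi> that True by (simp add: tail val_def)
    next
      case False
      then obtain z where z: "y = Suc z" "z \<ge> 1" using y by (cases y) auto
      define s where "s = val N z"
      have s: "s > 0" using z N by (simp add: s_def val_def)
      have vy: "val N y = s + 1 / real N" using valS z by (simp add: s_def)
      have "u (val N y) - u s \<le> pareto_mean_min \<pi> (val N y) - pareto_mean_min \<pi> s"
        using pareto_mean_min_mono [OF \<pi>, of s "val N y"] vy by (auto simp: u_def)
      also have "\<dots> \<le> min 1 (\<pi> / s) * (1 / real N)"
        using pareto_mean_min_tangent [OF \<pi> s, of "val N y"] v0 [of y] vy by simp
      finally have "real N * (u (val N y) - u s) \<le> real N * (min 1 (\<pi> / s) * (1 / real N))"
        by (intro mult_left_mono) auto
      then have "T y \<le> min 1 (\<pi> / s)"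
        using that z N0 by (simp add: T_def U_def s_def algebra_simps)
      then have "val N y * T y \<le> val N y * min 1 (\<pi> / s)"
        using v0 by (intro mult_left_mono) auto
      also have "\<dots> = s * min 1 (\<pi> / s) + 1 / real N * min 1 (\<pi> / s)"
        by (simp add: vy distrib_right)
      also have "\<dots> \<le> s * (\<pi> / s) + 1 / real N * 1"
        using s by (intro add_mono mult_left_mono) auto
      finally show ?thesis using s that by (simp add: tail)
    qed
  qed
qed

section \<open>Revenue of the exponential price mechanism\<close>

text \<open>Weak duality, with multiplier \<open>a\<close> on the constraint from \<open>m\<close>
  to \<open>Suc m\<close>. Since \<open>a\<close> times the price increment is
  \<open>P m + X\<close> and \<open>a\<close> times the allocation increment is \<open>A\<close>,
  the payment minus the weighted constraint is \<open>A * val N j - X\<close> below the top message.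
  At the top message the payment is \<open>A * c - X\<close>. The smaller of the two is a lower
  bound in terms of the value alone.\<close>

lemma revenue_exponential_ge:
  assumes pr: "is_prior N f" and A: "A > 0" and X: "X > 0" and k: "k \<ge> 1"
    and bce: "is_BCE N f (exp_M k) (exp_q k) (exp_P (A * real k) X) mu"
  shows "A * mean_min N f (X / A * (1 + 1 / (A * real k)) ^ k) - X
      \<le> revenue N (exp_M k) (exp_P (A * real k) X) mu"
proof -
  define a where "a = A * real k"
  define P where "P = exp_P a X"
  define c where "c = X / A * (1 + 1 / a) ^ k"
  define \<phi> where "\<phi> j = A * min (val N j) c - X" for j
  have a: "a > 0" using A k by (simp add: a_def)
  have mu: "\<And>j m. j \<le> N \<Longrightarrow> m \<le> k \<Longrightarrow> mu j m \<ge> 0"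
    "\<And>j. j \<le> N \<Longrightarrow> (\<Sum>m\<in>{0..k}. mu j m) = f j"
    and ob: "\<And>m m'. m \<le> k \<Longrightarrow> m' \<le> k \<Longrightarrow>
      (\<Sum>j\<le>N. mu j m * (util N (exp_q k) P j m - util N (exp_q k) P j m')) \<ge> 0"
    using bce by (auto simp: is_BCE_def exp_M_def P_def a_def)
  have cA: "A * c = X * (1 + 1 / a) ^ k" using A by (simp add: c_def)
  \<comment> \<open>The upward deviation constraint at each message below \<open>k\<close>, with multiplier \<open>a\<close>, cancels the
    exponential term of the payment.\<close>
  have step: "(\<Sum>j\<le>N. mu j m * \<phi> j) \<le> (\<Sum>j\<le>N. mu j m * P m)" if "m \<le> k" for m
  proof (cases "m = k")
    case True
    have "\<phi> j \<le> P k" for j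
    proof -
      have "A * min (val N j) c \<le> A * c" using A by (intro mult_left_mono) auto
      then show ?thesis by (simp add: \<phi>_def cA P_def exp_P_def algebra_simps)
    qed
    then show ?thesis using mu(1) True by (intro sum_mono mult_left_mono) auto
  next
    case False
    then have m: "Suc m \<le> k" using that by simp
    have "\<phi> j \<le> P m - a * (util N (exp_q k) P j m - util N (exp_q k) P j (Suc m))" for j
    proof -
      have "exp_q k (Suc m) - exp_q k m = 1 / real k"
        by (simp add: exp_q_def add_divide_distrib)
      moreover have "a * (P (Suc m) - P m) = X * (1 + 1 / a) ^ m"
      proof -
        have "P (Suc m) - P m = X * (1 + 1 / a) ^ m * (1 / a)"
          by (simp add: P_def exp_P_def algebra_simps)
        then show ?thesis using a by simp
      qed
      moreover have "a * (util N (exp_q k) P j m - util N (exp_q k) P j (Suc m))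
          = a * (P (Suc m) - P m) - a * val N j * (exp_q k (Suc m) - exp_q k m)"
        by (simp add: util_def algebra_simps)
      moreover have "a * val N j * (1 / real k) = A * val N j" using k by (simp add: a_def)
      ultimately have "P m - a * (util N (exp_q k) P j m - util N (exp_q k) P j (Suc m))
          = A * val N j - X"
        by (simp add: P_def exp_P_def algebra_simps)
      moreover have "A * min (val N j) c \<le> A * val N j" using A by (intro mult_left_mono) auto
      ultimately show ?thesis by (simp add: \<phi>_def)
    qed
    then have "(\<Sum>j\<le>N. mu j m * \<phi> j)
        \<le> (\<Sum>j\<le>N. mu j m * (P m - a * (util N (exp_q k) P j m - util N (exp_q k) P j (Suc m))))"
      using mu(1) that by (intro sum_mono mult_left_mono) auto
    also have "\<dots> = (\<Sum>j\<le>N. mu j m * P m)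
        - a * (\<Sum>j\<le>N. mu j m * (util N (exp_q k) P j m - util N (exp_q k) P j (Suc m)))"
      by (simp add: right_diff_distrib sum_subtractf sum_distrib_left mult_ac)
    also have "\<dots> \<le> (\<Sum>j\<le>N. mu j m * P m)"
      using a ob [of m "Suc m"] m by simp
    finally show ?thesis .
  qed
  have "A * mean_min N f c - X = (\<Sum>j\<le>N. f j * \<phi> j)"
  proof -
    have "(\<Sum>j\<le>N. f j * \<phi> j) = A * mean_min N f c - (\<Sum>j\<le>N. f j) * X"
      by (simp add: \<phi>_def mean_min_def right_diff_distrib sum_subtractf sum_distrib_left
          sum_distrib_right mult_ac)
    then show ?thesis using pr by (simp add: is_prior_def)
  qed
  also have "\<dots> = (\<Sum>j\<le>N. \<Sum>m\<in>{0..k}. mu j m * \<phi> j)"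
    using mu(2) by (intro sum.cong) (auto simp flip: sum_distrib_right)
  also have "\<dots> = (\<Sum>m\<in>{0..k}. \<Sum>j\<le>N. mu j m * \<phi> j)" by (rule sum.swap)
  also have "\<dots> \<le> (\<Sum>m\<in>{0..k}. \<Sum>j\<le>N. mu j m * P m)"
    using step by (intro sum_mono [of "{0..k}"]) auto
  also have "\<dots> = revenue N (exp_M k) P mu"
    unfolding revenue_def exp_M_def by (rule sum.swap)
  finally show ?thesis by (simp add: c_def P_def a_def)
qed

section \<open>Truncated means under a density\<close>

definition density_mean_min :: "(real \<Rightarrow> real) \<Rightarrow> real \<Rightarrow> real" where
  "density_mean_min \<rho> s = (LINT x:{0..1}|lborel. \<rho> x * min x s)"

lemma set_integrable_density_mult:
  assumes "density01 \<rho>" "w \<in> borel_measurable borel" "\<And>x. x \<in> {0..1} \<Longrightarrow> \<bar>w x\<bar> \<le> 1"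
  shows "set_integrable lborel {0..1} (\<lambda>x. \<rho> x * w x)"
proof -
  have \<rho>: "integrable lborel (\<lambda>x. indicator {0..1} x * \<rho> x)" "\<rho> \<in> borel_measurable borel"
    using assms(1) by (auto simp: density01_def set_integrable_def)
  have [measurable]: "\<rho> \<in> borel_measurable borel" "w \<in> borel_measurable borel"
    using \<rho> assms by auto
  have "integrable lborel (\<lambda>x. indicator {0..1} x * (\<rho> x * w x))"
  proof (rule Bochner_Integration.integrable_bound [OF \<rho>(1)])
    show "(\<lambda>x. indicator {0..1} x * (\<rho> x * w x)) \<in> borel_measurable lborel" by measurable
    show "AE x in lborel. norm (indicator {0..1} x * (\<rho> x * w x)) \<le> norm (indicator {0..1} x * \<rho> x)"
    proof (rule AE_I2)
      fix x :: real
      show "norm (indicator {0..1} x * (\<rho> x * w x)) \<le> norm (indicator {0..1} x * \<rho> x)"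
        using assms(3) [of x] mult_left_mono [of "\<bar>w x\<bar>" 1 "\<bar>\<rho> x\<bar>"]
        by (auto simp: indicator_def abs_mult)
    qed
  qed
  then show ?thesis by (simp add: set_integrable_def)
qed

text \<open>Here positivity of the density almost everywhere enters: a vanishing integral would make
  the interval from 0 to \<open>s\<close> a null set.\<close>

lemma set_integral_density_mult_pos:
  assumes \<rho>: "density01 \<rho>" and w: "w \<in> borel_measurable borel" "\<And>x. x \<in> {0..1} \<Longrightarrow> 0 \<le> w x \<and> w x \<le> 1"
    and s: "0 < s" "s \<le> 1" and pos: "\<And>x. 0 < x \<Longrightarrow> x < s \<Longrightarrow> 0 < w x"
  shows "0 < (LINT x:{0..1}|lborel. \<rho> x * w x)"
proof -
  have \<rho>0: "\<And>x. x \<in> {0..1} \<Longrightarrow> \<rho> x \<ge> 0" and \<rho>1: "AE x in lborel. x \<in> {0..1} \<longrightarrow> \<rho> x > 0"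
    using \<rho> by (auto simp: density01_def)
  have int: "integrable lborel (\<lambda>x. indicator {0..1} x * (\<rho> x * w x))"
    using set_integrable_density_mult [OF \<rho> w(1)] w(2) by (auto simp: set_integrable_def)
  have nn: "AE x in lborel. 0 \<le> indicator {0..1} x * (\<rho> x * w x)"
    using \<rho>0 w(2) by (intro AE_I2) (auto simp: indicator_def)
  have "(\<integral>x. indicator {0..1} x * (\<rho> x * w x) \<partial>lborel) \<noteq> 0"
  proof
    assume "(\<integral>x. indicator {0..1} x * (\<rho> x * w x) \<partial>lborel) = 0"
    then have "AE x in lborel. indicator {0..1} x * (\<rho> x * w x) = 0"
      using integral_nonneg_eq_0_iff_AE [OF int nn] by simp
    then have "AE x in lborel. x \<notin> {0<..<s}"
      using \<rho>1
    proof eventually_elim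
      case (elim x)
      then show ?case using pos [of x] s by (auto simp: indicator_def)
    qed
    then have "emeasure lborel {0<..<s} = 0"
      by (subst (asm) AE_iff_measurable [of "{0<..<s}"]) auto
    then show False using s by simp
  qed
  moreover have "0 \<le> (\<integral>x. indicator {0..1} x * (\<rho> x * w x) \<partial>lborel)"
    by (rule integral_nonneg_AE [OF nn])
  ultimately show ?thesis by (simp add: set_lebesgue_integral_def)
qed

context
  fixes \<rho> :: "real \<Rightarrow> real"
  assumes \<rho>: "density01 \<rho>"
begin

lemma density_mean_min_integrable:
  assumes "0 \<le> s" "s \<le> 1"
  shows "set_integrable lborel {0..1} (\<lambda>x. \<rho> x * min x s)"
  using assms by (intro set_integrable_density_mult [OF \<rho>]) auto

lemma density_mean_min_mono:
  assumes "0 \<le> s" "s \<le> t" "t \<le> 1"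
  shows "density_mean_min \<rho> s \<le> density_mean_min \<rho> t"
  unfolding density_mean_min_def
  using assms \<rho> by (intro set_integral_mono density_mean_min_integrable mult_left_mono)
    (auto simp: density01_def)

lemma density_mean_min_increment:
  assumes "0 \<le> s" "s \<le> t" "t \<le> 1"
  shows "density_mean_min \<rho> t \<le> density_mean_min \<rho> s + (t - s)"
proof -
  have \<rho>i: "set_integrable lborel {0..1} \<rho>" "(LINT x:{0..1}|lborel. \<rho> x) = 1"
    using \<rho> by (auto simp: density01_def)
  have si: "set_integrable lborel {0..1} (\<lambda>x. \<rho> x * min x s)"
    using assms by (intro density_mean_min_integrable) auto
  have "density_mean_min \<rho> t \<le> (LINT x:{0..1}|lborel. \<rho> x * min x s + \<rho> x * (t - s))"
    unfolding density_mean_min_def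
  proof (rule set_integral_mono)
    show "set_integrable lborel {0..1} (\<lambda>x. \<rho> x * min x t)"
      using assms by (intro density_mean_min_integrable) auto
    show "set_integrable lborel {0..1} (\<lambda>x. \<rho> x * min x s + \<rho> x * (t - s))"
      using si \<rho>i by (intro set_integral_add) auto
    show "\<rho> x * min x t \<le> \<rho> x * min x s + \<rho> x * (t - s)" if "x \<in> {0..1}" for x
      unfolding distrib_left [symmetric]
      using that assms \<rho> by (intro mult_left_mono) (auto simp: density01_def)
  qed
  also have "\<dots> = density_mean_min \<rho> s + (t - s)"
    using si \<rho>i by (subst set_integral_add) (auto simp: density_mean_min_def)
  finally show ?thesis .
qed

text \<open>Strictness separates the contact point \<open>b\<close> from \<pi>, so that
  \<open>ln (b / \<pi>)\<close> is positive and \<open>A\<close> is well defined.\<close>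

lemma density_mean_min_less:
  assumes "0 < s" "s \<le> 1"
  shows "density_mean_min \<rho> s < s"
proof -
  have \<rho>i: "set_integrable lborel {0..1} \<rho>" "(LINT x:{0..1}|lborel. \<rho> x) = 1"
    using \<rho> by (auto simp: density01_def)
  have si: "set_integrable lborel {0..1} (\<lambda>x. \<rho> x * min x s)"
    using assms by (intro density_mean_min_integrable) auto
  have "0 < (LINT x:{0..1}|lborel. \<rho> x * (s - min x s))"
    using assms by (intro set_integral_density_mult_pos [OF \<rho>, where s = s]) auto
  also have "\<dots> = (LINT x:{0..1}|lborel. \<rho> x * s - \<rho> x * min x s)"
    by (simp add: right_diff_distrib)
  also have "\<dots> = s - density_mean_min \<rho> s"
    using si \<rho>i by (subst set_integral_diff) (auto simp: density_mean_min_def)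
  finally show ?thesis by simp
qed

lemma density_mean_min_pos: "0 < density_mean_min \<rho> 1"
  unfolding density_mean_min_def
  by (intro set_integral_density_mult_pos [OF \<rho>, where s = 1]) auto

lemma continuous_on_density_mean_min: "continuous_on {0..1} (density_mean_min \<rho>)"
proof (rule lipschitz_on_continuous_on [where L = 1], rule lipschitz_onI)
  fix s t :: real assume "s \<in> {0..1}" "t \<in> {0..1}"
  then show "dist (density_mean_min \<rho> s) (density_mean_min \<rho> t) \<le> 1 * dist s t"
    using density_mean_min_mono [of s t] density_mean_min_increment [of s t]
      density_mean_min_mono [of t s] density_mean_min_increment [of t s]
    by (cases "s \<le> t") (auto simp: dist_real_def)
qed simp

end

section \<open>The limiting problem\<close>

text \<open>The pair is a maximiser of the first coordinate over the compact set \<open>K\<close> of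
  pairs at which the Pareto curve does not exceed \<open>h\<close>. Maximality puts every curve with
  a larger parameter strictly above \<open>h\<close>.\<close>

lemma exists_optimal_pareto:
  fixes h :: "real \<Rightarrow> real"
  assumes cont: "continuous_on {0..1} h" and less: "\<And>s. 0 < s \<Longrightarrow> s \<le> 1 \<Longrightarrow> h s < s"
    and pos: "0 < h 1"
  obtains \<pi> b where "0 < \<pi>" "\<pi> < b" "b \<le> 1" "\<pi> * (1 + ln (b / \<pi>)) \<le> h b"
    "\<And>\<pi>' s. \<pi> < \<pi>' \<Longrightarrow> \<pi>' \<le> s \<Longrightarrow> s \<le> 1 \<Longrightarrow> h s < \<pi>' * (1 + ln (s / \<pi>'))"
proof -
  define r where "r = h 1 / 2"
  have r: "0 < r" "r < 1" using pos less [of 1] by (auto simp: r_def)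
  \<comment> \<open>A positive lower bound on the parameter keeps the logarithm continuous on
    \<open>K\<close>. With \<open>h 1 = 2 * r\<close>, the estimate \<open>ln x \<le> x - 1\<close>
    at \<open>1 / r\<close> puts \<open>(p0, 1)\<close> into \<open>K\<close>.\<close>
  define p0 where "p0 = r\<^sup>2"
  have p0: "0 < p0" "p0 \<le> 1" using r by (auto simp: p0_def power_le_one)
  have init: "p0 * (1 + ln (1 / p0)) \<le> h 1"
  proof -
    have "ln (1 / p0) = 2 * ln (1 / r)" using r by (simp add: p0_def ln_div ln_realpow)
    also have "\<dots> \<le> 2 * (1 / r - 1)" using r ln_le_minus_one [of "1 / r"] by simp
    finally have "p0 * (1 + ln (1 / p0)) \<le> p0 * (1 + 2 * (1 / r - 1))"
      using p0 by (intro mult_left_mono) auto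
    also have "\<dots> = 2 * r - p0" using r by (simp add: p0_def power2_eq_square field_simps)
    finally show ?thesis using p0 by (simp add: r_def)
  qed
  define K1 where "K1 = {z \<in> {p0..1} \<times> {0..1::real}. fst z \<le> snd z}"
  have K1: "closed K1"
    unfolding K1_def
    by (intro continuous_on_closed_Collect_le closed_Times continuous_intros)
  define K where "K = {z \<in> K1. fst z * (1 + ln (snd z / fst z)) \<le> h (snd z)}"
  have "closed K"
    unfolding K_def
  proof (intro continuous_on_closed_Collect_le K1)
    have *: "fst z > 0" "snd z > 0" if "z \<in> K1" for z
      using that p0 by (auto simp: K1_def)
    show "continuous_on K1 (\<lambda>z. fst z * (1 + ln (snd z / fst z)))"
      by (intro continuous_intros) (use * in force)+
    show "continuous_on K1 (\<lambda>z. h (snd z))"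
      by (intro continuous_on_compose2 [OF cont] continuous_intros) (auto simp: K1_def)
  qed
  moreover have "K \<subseteq> {p0..1} \<times> {0..1}" by (auto simp: K_def K1_def)
  ultimately have "compact K"
    using compact_Int_closed [of "{p0..1} \<times> {0..1::real}" K] compact_Times
    by (metis Int_absorb1 compact_Icc)
  moreover have "(p0, 1) \<in> K" using p0 init by (auto simp: K_def K1_def)
  ultimately obtain z where z: "z \<in> K" "\<And>y. y \<in> K \<Longrightarrow> fst y \<le> fst z"
    using continuous_attains_sup [of K fst] continuous_on_fst [OF continuous_on_id] by blast
  obtain \<pi> b where zp: "z = (\<pi>, b)" by (cases z)
  have \<pi>: "0 < \<pi>" "p0 \<le> \<pi>" "\<pi> \<le> b" "b \<le> 1" "\<pi> * (1 + ln (b / \<pi>)) \<le> h b"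
    using z(1) p0 by (auto simp: zp K_def K1_def)
  show thesis
  proof
    show "\<pi> < b"
    proof (rule ccontr)
      assume "\<not> \<pi> < b"
      then have "b = \<pi>" using \<pi> by simp
      then show False using \<pi> less [of b] by simp
    qed
    show "h s < \<pi>' * (1 + ln (s / \<pi>'))" if "\<pi> < \<pi>'" "\<pi>' \<le> s" "s \<le> 1" for \<pi>' s
    proof (rule ccontr)
      assume "\<not> ?thesis"
      then have "(\<pi>', s) \<in> K" using that \<pi> by (auto simp: K_def K1_def)
      then show False using z(2) [of "(\<pi>', s)"] that zp by simp
    qed
  qed (use \<pi> in auto)
qed

section \<open>Truncated means of discrete priors and their convergence\<close>

lemma mean_min_mono:
  assumes "is_prior N f" "s \<le> t"
  shows "mean_min N f s \<le> mean_min N f t"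
  unfolding mean_min_def using assms
  by (intro sum_mono mult_left_mono) (auto simp: is_prior_def)

lemma mean_min_increment:
  assumes "is_prior N f" "s \<le> t"
  shows "mean_min N f t \<le> mean_min N f s + (t - s)"
proof -
  have "mean_min N f t \<le> (\<Sum>j\<le>N. f j * (min (val N j) s + (t - s)))"
    unfolding mean_min_def using assms
    by (intro sum_mono mult_left_mono) (auto simp: is_prior_def)
  also have "\<dots> = mean_min N f s + (\<Sum>j\<le>N. f j) * (t - s)"
    by (simp add: mean_min_def distrib_left sum.distrib sum_distrib_right)
  finally show ?thesis using assms by (simp add: is_prior_def)
qed

lemma mean_min_le:
  assumes "is_prior N f"
  shows "mean_min N f s \<le> s"
proof -
  have "mean_min N f s \<le> (\<Sum>j\<le>N. f j * s)"
    unfolding mean_min_def using assms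
    by (intro sum_mono mult_left_mono) (auto simp: is_prior_def)
  also have "\<dots> = s" using assms by (simp add: is_prior_def flip: sum_distrib_right)
  finally show ?thesis .
qed

text \<open>On the interval from \<pi> to 1 the gap has a positive minimum \<eta> by compactness.
  Pointwise convergence on a finite grid of mesh below \<open>\<eta> / 2\<close> then suffices,
  because the discrete truncated means are increasing and \<open>h\<close> grows with slope at most
  1. Below \<pi> the trivial bound \<open>mean_min_le\<close> applies.\<close>

lemma eventually_mean_min_le_pareto:
  fixes h :: "real \<Rightarrow> real" and p :: "nat \<Rightarrow> nat \<Rightarrow> real"
  assumes pr: "\<And>N. N \<ge> 1 \<Longrightarrow> is_prior N (p N)"
    and lim: "\<And>s. 0 \<le> s \<Longrightarrow> s \<le> 1 \<Longrightarrow> (\<lambda>N. mean_min N (p N) s) \<longlonglongrightarrow> h s"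
    and cont: "continuous_on {0..1} h"
    and incr: "\<And>s t. 0 \<le> s \<Longrightarrow> s \<le> t \<Longrightarrow> t \<le> 1 \<Longrightarrow> h t \<le> h s + (t - s)"
    and \<pi>: "0 < \<pi>" and less: "\<And>s. \<pi> \<le> s \<Longrightarrow> s \<le> 1 \<Longrightarrow> h s < \<pi> * (1 + ln (s / \<pi>))"
  shows "\<forall>\<^sub>F N in sequentially. \<forall>s\<in>{0..1}. mean_min N (p N) s \<le> pareto_mean_min \<pi> s"
proof (cases "\<pi> \<le> 1")
  case False
  show ?thesis
    using eventually_ge_at_top [of 1]
    by eventually_elim (use False pr mean_min_le in \<open>auto simp: pareto_mean_min_def\<close>)
next
  case True
  define G where "G s = \<pi> * (1 + ln (s / \<pi>)) - h s" for s
  have "continuous_on {\<pi>..1} h" using cont by (rule continuous_on_subset) (use \<pi> in auto)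
  then have "continuous_on {\<pi>..1} G"
    unfolding G_def by (intro continuous_intros) (use \<pi> in auto)
  then obtain s0 where s0: "s0 \<in> {\<pi>..1}" "\<And>s. s \<in> {\<pi>..1} \<Longrightarrow> G s0 \<le> G s"
    using continuous_attains_inf [of "{\<pi>..1}" G] True by auto
  define \<eta> where "\<eta> = G s0"
  have \<eta>: "0 < \<eta>" using s0 less [of s0] by (simp add: \<eta>_def G_def)
  obtain n where n: "n \<noteq> 0" "1 / real n < \<eta> / 2"
    using reals_Archimedean [of "\<eta> / 2"] \<eta> by (metis half_gt_zero inverse_eq_divide nat.distinct(1))
  have "\<forall>\<^sub>F N in sequentially. \<forall>i\<in>{..n}. mean_min N (p N) (real i / real n) < h (real i / real n) + \<eta> / 2"
  proof (rule eventually_ball_finite)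
    show "\<forall>i\<in>{..n}. \<forall>\<^sub>F N in sequentially. mean_min N (p N) (real i / real n) < h (real i / real n) + \<eta> / 2"
      using n \<eta> by (intro ballI order_tendstoD(2) [OF lim]) auto
  qed simp
  then show ?thesis
    using eventually_ge_at_top [of 1]
  proof eventually_elim
    case (elim N)
    show ?case
    proof
      fix s :: real assume s: "s \<in> {0..1}"
      show "mean_min N (p N) s \<le> pareto_mean_min \<pi> s"
      proof (cases "s \<le> \<pi>")
        case True
        then show ?thesis using mean_min_le pr elim by (simp add: pareto_mean_min_def)
      next
        case False
        \<comment> \<open>Rounding up lets monotonicity pass from \<open>s\<close> to the grid
          point.\<close>
        define i where "i = nat \<lceil>s * real n\<rceil>"
        have sn: "0 \<le> s * real n" using s by simp
        have i: "s * real n \<le> real i" "real i < s * real n + 1"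
          using sn unfolding i_def by linarith+
        have "s * real n \<le> 1 * real n" using s by (intro mult_right_mono) auto
        then have "i \<le> n" unfolding i_def by (simp add: ceiling_le_iff)
        have st: "s \<le> real i / real n" "real i / real n \<le> s + 1 / real n"
          using i n by (auto simp: field_simps)
        have "real i / real n \<le> 1" using \<open>i \<le> n\<close> n by simp
        have "mean_min N (p N) s \<le> mean_min N (p N) (real i / real n)"
          using st pr elim by (intro mean_min_mono) auto
        also have "\<dots> \<le> h (real i / real n) + \<eta> / 2" using elim \<open>i \<le> n\<close> by (simp add: less_imp_le)
        also have "\<dots> \<le> h s + \<eta>"
          using incr [of s "real i / real n"] s st \<open>real i / real n \<le> 1\<close> n by auto
        also have "\<dots> \<le> \<pi> * (1 + ln (s / \<pi>))"
          using s0(2) [of s] False s by (simp add: \<eta>_def G_def)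
        finally show ?thesis using False by (simp add: pareto_mean_min_def)
      qed
    qed
  qed
qed

section \<open>Choice of the constants and passage to the limit\<close>

theorem theorem1:
  fixes rho :: "real \<Rightarrow> real"
  assumes "density01 rho"
  shows "\<exists>A>0. \<exists>X>0. \<forall>p :: nat \<Rightarrow> nat \<Rightarrow> real.
           (\<forall>N\<ge>1. is_prior N (p N)) \<and> weak_conv p rho \<longrightarrow>
           (\<forall>\<epsilon>>0. \<exists>nubar>0. \<exists>kbar\<ge>1. \<forall>N\<ge>1. \<forall>k\<ge>kbar. 1 / real N \<le> nubar \<longrightarrow>
              guarantees N (p N) (exp_M k) (exp_q k) (exp_P (A * real k) X)
                (R_star N (p N) - \<epsilon>))"
proof -
  define h where "h = density_mean_min rho"
  note cont = continuous_on_density_mean_min [OF assms, folded h_def]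
  obtain \<pi> b where \<pi>: "0 < \<pi>" "\<pi> < b" "b \<le> 1" and touch: "\<pi> * (1 + ln (b / \<pi>)) \<le> h b"
    and above: "\<And>\<pi>' s. \<pi> < \<pi>' \<Longrightarrow> \<pi>' \<le> s \<Longrightarrow> s \<le> 1 \<Longrightarrow> h s < \<pi>' * (1 + ln (s / \<pi>'))"
    using exists_optimal_pareto [of h] cont density_mean_min_less [OF assms]
      density_mean_min_pos [OF assms] unfolding h_def by blast
  define A where "A = 1 / ln (b / \<pi>)"
  define X where "X = A * \<pi>"
  have A: "A > 0" using \<pi> by (simp add: A_def)
  have X: "X > 0" using A \<pi> by (simp add: X_def)
  have val_b: "\<pi> \<le> A * h b - X"
  proof -
    have "A * (\<pi> * (1 + ln (b / \<pi>))) \<le> A * h b" using touch A by (intro mult_left_mono) auto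
    moreover have "A * (\<pi> * (1 + ln (b / \<pi>))) = X + \<pi> * (A * ln (b / \<pi>))"
      by (simp add: X_def algebra_simps)
    moreover have "A * ln (b / \<pi>) = 1" using \<pi> by (simp add: A_def)
    ultimately show ?thesis by simp
  qed
  define c where "c k = X / A * (1 + 1 / (A * real k)) ^ k" for k
  have "c \<longlonglongrightarrow> \<pi> * exp (1 / A)"
  proof -
    have "(\<lambda>k. \<pi> * (1 + (1 / A) / real k) ^ k) \<longlonglongrightarrow> \<pi> * exp (1 / A)"
      by (intro tendsto_intros tendsto_exp_limit_sequentially)
    moreover have "c = (\<lambda>k. \<pi> * (1 + (1 / A) / real k) ^ k)"
      using A by (auto simp: c_def X_def)
    ultimately show ?thesis by simp
  qed
  moreover have "\<pi> * exp (1 / A) = b" using \<pi> by (simp add: A_def)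
  ultimately have c_lim: "c \<longlonglongrightarrow> b" by simp
  show ?thesis
  proof (rule exI [of _ A], rule conjI [OF A], rule exI [of _ X], rule conjI [OF X],
      intro allI impI, elim conjE)
    fix p :: "nat \<Rightarrow> nat \<Rightarrow> real" and \<epsilon> :: real
    assume pr: "\<forall>N\<ge>1. is_prior N (p N)" and wc: "weak_conv p rho" and \<epsilon>: "\<epsilon> > 0"
    have lim: "(\<lambda>N. mean_min N (p N) s) \<longlonglongrightarrow> h s" for s
    proof -
      have "continuous_on {0..1} (\<lambda>x. min x s)" by (intro continuous_intros)
      then show ?thesis
        using wc unfolding weak_conv_def mean_min_def h_def density_mean_min_def by blast
    qed
    \<comment> \<open>The error budget: raising \<pi> and the grid term cost one \<eta> each in the
      upper bound; replacing \<open>h\<close> by the discrete truncated mean and \<open>b\<close> by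
      \<open>c k\<close> cost \<open>\<eta> / A\<close> each, multiplied by \<open>A\<close>, in the
      lower bound.\<close>
    define \<eta> where "\<eta> = \<epsilon> / 4"
    have \<eta>: "\<eta> > 0" using \<epsilon> by (simp add: \<eta>_def)
    have \<eta>A: "\<eta> / A > 0" using \<eta> A by simp
    \<comment> \<open>The parameter is raised by \<eta> because at \<pi> itself the inequality is
      tight at \<open>b\<close> and leaves no room for the convergence error.\<close>
    have "\<forall>\<^sub>F N in sequentially. \<forall>s\<in>{0..1}. mean_min N (p N) s \<le> pareto_mean_min (\<pi> + \<eta>) s"
      using pr lim cont density_mean_min_increment [OF assms] \<pi> \<eta> above [of "\<pi> + \<eta>"]
      by (intro eventually_mean_min_le_pareto [where h = h]) (auto simp: h_def)
    moreover have "\<forall>\<^sub>F N in sequentially. h b - \<eta> / A < mean_min N (p N) b"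
      using \<eta>A by (intro order_tendstoD(1) [OF lim]) auto
    ultimately have "\<forall>\<^sub>F N in sequentially.
        (\<forall>s\<in>{0..1}. mean_min N (p N) s \<le> pareto_mean_min (\<pi> + \<eta>) s)
        \<and> h b - \<eta> / A < mean_min N (p N) b"
      by (rule eventually_conj)
    then obtain N0 where N0: "\<And>N. N \<ge> N0 \<Longrightarrow>
        (\<forall>s\<in>{0..1}. mean_min N (p N) s \<le> pareto_mean_min (\<pi> + \<eta>) s)
        \<and> h b - \<eta> / A < mean_min N (p N) b"
      by (auto simp: eventually_sequentially)
    have "\<forall>\<^sub>F k in sequentially. b - \<eta> / A < c k"
      using \<eta>A by (intro order_tendstoD(1) [OF c_lim]) auto
    then obtain k0 where k0: "\<And>k. k \<ge> k0 \<Longrightarrow> b - \<eta> / A < c k"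
      by (auto simp: eventually_sequentially)
    define nubar where "nubar = min \<eta> (1 / real (Suc N0))"
    have nubar: "nubar > 0" using \<eta> by (simp add: nubar_def)
    have main: "guarantees N (p N) (exp_M k) (exp_q k) (exp_P (A * real k) X) (R_star N (p N) - \<epsilon>)"
      if N: "N \<ge> 1" and k: "k \<ge> max 1 k0" and nu: "1 / real N \<le> nubar" for N k
    proof -
      have prN: "is_prior N (p N)" using pr N by simp
      have "1 / real N \<le> 1 / real (Suc N0)" using nu by (simp add: nubar_def)
      then have "N \<ge> N0" using N by (simp add: divide_le_eq le_divide_eq split: if_splits)
      note N0 = N0 [OF this]
      have "R_star N (p N) \<le> \<pi> + \<eta> + 1 / real N"
        using \<pi> \<eta> N N0 by (intro R_star_le prN) (auto simp: val_def)
      also have "\<dots> \<le> \<pi> + 2 * \<eta>" using nu by (simp add: nubar_def)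
      finally have up: "R_star N (p N) \<le> \<pi> + 2 * \<eta>" .
      \<comment> \<open>Only a lower bound on \<open>c k\<close> is needed, as truncated means are
        increasing in the truncation point.\<close>
      have "mean_min N (p N) b - \<eta> / A \<le> mean_min N (p N) (c k)"
        using mean_min_increment [OF prN, of "b - \<eta> / A" b] k0 [of k] k \<eta>A
          mean_min_mono [OF prN, of "b - \<eta> / A" "c k"] by simp
      then have "h b - 2 * (\<eta> / A) \<le> mean_min N (p N) (c k)" using N0 by simp
      then have "A * (h b - 2 * (\<eta> / A)) \<le> A * mean_min N (p N) (c k)"
        using A by (intro mult_left_mono) auto
      then have low: "\<pi> - 2 * \<eta> \<le> A * mean_min N (p N) (c k) - X"
        using val_b A by (simp add: right_diff_distrib)
      show ?thesis
        unfolding guarantees_def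
      proof (intro allI impI)
        fix mu assume "is_BCE N (p N) (exp_M k) (exp_q k) (exp_P (A * real k) X) mu"
        from revenue_exponential_ge [OF prN A X _ this]
        show "R_star N (p N) - \<epsilon> \<le> revenue N (exp_M k) (exp_P (A * real k) X) mu"
          using k up low by (simp add: c_def \<eta>_def)
      qed
    qed
    show "\<exists>nubar>0. \<exists>kbar\<ge>1. \<forall>N\<ge>1. \<forall>k\<ge>kbar. 1 / real N \<le> nubar \<longrightarrow>
        guarantees N (p N) (exp_M k) (exp_q k) (exp_P (A * real k) X) (R_star N (p N) - \<epsilon>)"
      by (rule exI [of _ nubar], rule conjI [OF nubar], rule exI [of _ "max 1 k0"]) (use main in auto)
  qed
qed

end
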